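(* Assume that $(A,B)$ is stabilizable, $(C,A)$ is detectable, and $\operatorname{Ker} C\subseteq \big(\bigcap_{i=1}^r \operatorname{Ker} A_0^i\big)\cap \operatorname{Ker} L^{\top}$, where $C^{\top}C=Q-LR^{-1}L^{\top}$ is a full rank decomposition. Let $\widehat X\ge 0$ be a solution of the stochastic continuous-time algebraic Riccati equation (SCARE) $\mathcal R(X)=0$. Let $\{X_k\}_{k=0}^\infty$ be the sequence defined by $X_0=0$ and, for each $k\ge 0$, $X_{k+1}$ is the (unique) positive semidefinite stabilizing solution $X$ of the continuous-time algebraic Riccati equation $$A_k^{\top}X+XA_k-XG_kX+H_k=0,\qquad A_k=A_c(X_k),\ G_k=G_c(X_k),\ H_k=H_c(X_k).$$ Then: (i) for each $k\ge 0$, $X_k\le X_{k+1}$, $X_k\le \widehat X$, $\mathcal R(X_k)\ge 0$, and $A_k-G_k\widehat X$ is stable; (ii) $\lim_{k\to\infty}X_k=\widehat X_-$, where $\widehat X_-\le \widehat X$ is a solution of the SCARE $\mathcal R(X)=0$; (iii) $\sigma\big(A_c(\widehat X_-)-G_c(\widehat X_-)\widehat X_-\big)\subset \mathbb C_-\cup i\mathbb R$.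
   Context: Data: $A,A_0^i\in\mathbb R^{n\times n}$, $B,B_0^i\in\mathbb R^{n\times m}$ ($i=1,\dots,r$), $Q=Q^{\top}\in\mathbb R^{n\times n}$, $L\in\mathbb R^{n\times m}$, $R=R^{\top}\in\mathbb R^{m\times m}$ with $R>0$ and $Q-LR^{-1}L^{\top}\ge 0$. For symmetric matrices, $X\ge Y$ (resp. $X>Y$) means $X-Y$ is positive semidefinite (resp. positive definite). For symmetric $X\in\mathbb R^{n\times n}$: $\Pi_{11}(X)=\sum_{i=1}^r A_0^{i\top}XA_0^i$, $\Pi_{12}(X)=\sum_{i=1}^r A_0^{i\top}XB_0^i$, $\Pi_{22}(X)=\sum_{i=1}^r B_0^{i\top}XB_0^i$; $L_c(X)=L+\Pi_{12}(X)$, $R_c(X)=R+\Pi_{22}(X)$, $Q_c(X)=Q+\Pi_{11}(X)$. For $X\ge0$ one has $R_c(X)>0$ and $A_c(X)=A-BR_c(X)^{-1}L_c(X)^{\top}$, $G_c(X)=BR_c(X)^{-1}B^{\top}$, $H_c(X)=Q_c(X)-L_c(X)R_c(X)^{-1}L_c(X)^{\top}$, $\mathcal R(X)=A_c(X)^{\top}X+XA_c(X)-XG_c(X)X+H_c(X)$. A square matrix is stable if all its eigenvalues lie in the open left half-plane $\mathbb C_-$; $\sigma(\cdot)$ is the spectrum. $(A,B)$ is stabilizable if $y^{*}A=\lambda y^{*}$, $\operatorname{Re}\lambda\ge0$, $y^{*}B=0$ imply $y=0$; $(C,A)$ is detectable if $Ax=\lambda x$, $\operatorname{Re}\lambda\ge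 0$, $Cx=0$ imply $x=0$. A solution $X$ of $A_k^{\top}X+XA_k-XG_kX+H_k=0$ is stabilizing if $A_k-G_kX$ is stable. *)

theory Defs
  imports "HOL-Analysis.Analysis"
begin

text \<open>A real matrix with \<open>m\<close> rows and \<open>n\<close> columns has type \<open>real^'n^'m\<close>.\<close>

definition pos_semidef :: "real^'n^'n \<Rightarrow> bool" where
  "pos_semidef M \<longleftrightarrow> transpose M = M \<and> (\<forall>x. 0 \<le> x \<bullet> (M *v x))"

definition pos_def :: "real^'n^'n \<Rightarrow> bool" where
  "pos_def M \<longleftrightarrow> transpose M = M \<and> (\<forall>x. x \<noteq> 0 \<longrightarrow> 0 < x \<bullet> (M *v x))"

definition loewner_le :: "real^'n^'n \<Rightarrow> real^'n^'n \<Rightarrow> bool" (infix \<open>\<preceq>\<close> 50) where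
  "X \<preceq> Y \<longleftrightarrow> pos_semidef (Y - X)"

definition mat_ker :: "real^'n^'m \<Rightarrow> (real^'n) set" where
  "mat_ker M = {x. M *v x = 0}"

definition cmat :: "real^'n^'m \<Rightarrow> complex^'n^'m" where
  "cmat M = (\<chi> i j. complex_of_real (M $ i $ j))"

definition vec_cnj :: "complex^'n \<Rightarrow> complex^'n" where
  "vec_cnj y = (\<chi> i. cnj (y $ i))"

text \<open>The spectrum of a real matrix consists of its complex eigenvalues.\<close>

definition spectrum :: "real^'n^'n \<Rightarrow> complex set" where
  "spectrum M = {z. \<exists>v. v \<noteq> 0 \<and> cmat M *v v = z *s v}"

definition stable :: "real^'n^'n \<Rightarrow> bool" where
  "stable M \<longleftrightarrow> (\<forall>z\<in>spectrum M. Re z < 0)"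

definition stabilizable :: "real^'n^'n \<Rightarrow> real^'m^'n \<Rightarrow> bool" where
  "stabilizable A B \<longleftrightarrow>
     (\<forall>z y. vec_cnj y v* cmat A = z *s vec_cnj y \<and> 0 \<le> Re z \<and> vec_cnj y v* cmat B = 0
        \<longrightarrow> y = 0)"

definition detectable :: "real^'n^'p \<Rightarrow> real^'n^'n \<Rightarrow> bool" where
  "detectable C A \<longleftrightarrow>
     (\<forall>z x. cmat A *v x = z *s x \<and> 0 \<le> Re z \<and> cmat C *v x = 0 \<longrightarrow> x = 0)"

text \<open>
  \<open>C\<close> has full row rank. As the row index type of \<open>C\<close> is nonempty, the factor of \<open>M = 0\<close>,
  which has no rows, cannot be written down literally; it is represented by \<open>C = 0\<close>, which
  has the same kernel (the first conjunct forces \<open>C = 0\<close> when \<open>M = 0\<close>).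
\<close>

definition full_rank_decomposition :: "real^'n^'p \<Rightarrow> real^'n^'n \<Rightarrow> bool" where
  "full_rank_decomposition (C :: real^'n^'p) M \<longleftrightarrow>
     transpose C ** C = M \<and> (rank C = CARD('p) \<or> M = 0)"

text \<open>
  The families \<open>A\<^sub>0\<^sup>i\<close> and \<open>B\<^sub>0\<^sup>i\<close> are relevant only for indices \<open>1 \<le> i \<le> r\<close>.
\<close>

record ('n::finite, 'm::finite) scare_data =
  sys_A  :: "real^'n^'n"
  sys_B  :: "real^'m^'n"
  sys_r  :: nat
  sys_A0 :: "nat \<Rightarrow> real^'n^'n"
  sys_B0 :: "nat \<Rightarrow> real^'m^'n"
  sys_Q  :: "real^'n^'n"
  sys_L  :: "real^'m^'n"
  sys_R  :: "real^'m^'m"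

definition Pi11 :: "('n::finite, 'm::finite) scare_data \<Rightarrow> real^'n^'n \<Rightarrow> real^'n^'n" where
  "Pi11 D X = (\<Sum>i=1..sys_r D. transpose (sys_A0 D i) ** X ** sys_A0 D i)"

definition Pi12 :: "('n::finite, 'm::finite) scare_data \<Rightarrow> real^'n^'n \<Rightarrow> real^'m^'n" where
  "Pi12 D X = (\<Sum>i=1..sys_r D. transpose (sys_A0 D i) ** X ** sys_B0 D i)"

definition Pi22 :: "('n::finite, 'm::finite) scare_data \<Rightarrow> real^'n^'n \<Rightarrow> real^'m^'m" where
  "Pi22 D X = (\<Sum>i=1..sys_r D. transpose (sys_B0 D i) ** X ** sys_B0 D i)"

definition Lc :: "('n::finite, 'm::finite) scare_data \<Rightarrow> real^'n^'n \<Rightarrow> real^'m^'n" where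
  "Lc D X = sys_L D + Pi12 D X"

definition Rc :: "('n::finite, 'm::finite) scare_data \<Rightarrow> real^'n^'n \<Rightarrow> real^'m^'m" where
  "Rc D X = sys_R D + Pi22 D X"

definition Qc :: "('n::finite, 'm::finite) scare_data \<Rightarrow> real^'n^'n \<Rightarrow> real^'n^'n" where
  "Qc D X = sys_Q D + Pi11 D X"

text \<open>The inverse of \<open>Rc D X\<close> is meaningful for positive semidefinite \<open>X\<close>, where \<open>Rc D X\<close> is
  positive definite; the definitions below are only of interest for such \<open>X\<close>.\<close>

definition Ac :: "('n::finite, 'm::finite) scare_data \<Rightarrow> real^'n^'n \<Rightarrow> real^'n^'n" where
  "Ac D X = sys_A D - sys_B D ** matrix_inv (Rc D X) ** transpose (Lc D X)"

definition Gc :: "('n::finite, 'm::finite) scare_data \<Rightarrow> real^'n^'n \<Rightarrow> real^'n^'n" where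
  "Gc D X = sys_B D ** matrix_inv (Rc D X) ** transpose (sys_B D)"

definition Hc :: "('n::finite, 'm::finite) scare_data \<Rightarrow> real^'n^'n \<Rightarrow> real^'n^'n" where
  "Hc D X = Qc D X - Lc D X ** matrix_inv (Rc D X) ** transpose (Lc D X)"

definition care_op :: "real^'n^'n \<Rightarrow> real^'n^'n \<Rightarrow> real^'n^'n \<Rightarrow> real^'n^'n \<Rightarrow> real^'n^'n" where
  "care_op A G H X = transpose A ** X + X ** A - X ** G ** X + H"

definition scare_op :: "('n::finite, 'm::finite) scare_data \<Rightarrow> real^'n^'n \<Rightarrow> real^'n^'n" where
  "scare_op D X = care_op (Ac D X) (Gc D X) (Hc D X) X"

definition psd_stabilizing_solution ::
    "real^'n^'n \<Rightarrow> real^'n^'n \<Rightarrow> real^'n^'n \<Rightarrow> real^'n^'n \<Rightarrow> bool" where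
  "psd_stabilizing_solution A G H X \<longleftrightarrow>
     pos_semidef X \<and> care_op A G H X = 0 \<and> stable (A - G ** X)"

definition scare_iteration ::
    "('n::finite, 'm::finite) scare_data \<Rightarrow> (nat \<Rightarrow> real^'n^'n) \<Rightarrow> bool" where
  "scare_iteration D X \<longleftrightarrow>
     X 0 = 0 \<and>
     (\<forall>k. psd_stabilizing_solution (Ac D (X k)) (Gc D (X k)) (Hc D (X k)) (X (Suc k)))"

end

theory Submission
  imports Defs "HOL-Computational_Algebra.Fundamental_Theorem_Algebra"
begin

text \<open>
  For fixed \<open>Y \<ge> 0\<close> the Riccati map of the iteration is the Schur complement of a block matrix
  that is affine and monotone in \<open>Y\<close>, hence it is itself monotone in \<open>Y\<close>. As long as
  \<open>X\<^sub>k \<le> Xhat\<close>, the matrix \<open>Xhat\<close> is therefore a supersolution of the \<open>k\<close>-th Riccati equation.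
  Monotonicity also gives \<open>H\<^sub>k \<ge> C\<^sup>T C\<close>, so the kernel condition passes detectability on to
  \<open>(H\<^sub>k, A\<^sub>k)\<close>, and then every psd supersolution yields a stable closed loop. Newton's method
  started at \<open>Xhat\<close> produces the stabilizing solution \<open>X\<^sub>k\<^sub>+\<^sub>1\<close>, and Lyapunov comparison gives
  \<open>X\<^sub>k \<le> X\<^sub>k\<^sub>+\<^sub>1 \<le> Xhat\<close>. The limit is again a psd solution of a detectable equation, so its closed
  loop is even stable, which is more than (iii).
\<close>

section \<open>Stable matrices and decay of powers\<close>

text \<open>The vector a + i b. Splitting into real and imaginary parts turns spectral conditions on
  real matrices into statements about real vectors, to which real quadratic forms apply.\<close>

definition cvec :: "real^'n \<Rightarrow> real^'n \<Rightarrow> complex^'n" where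
  "cvec a b = (\<chi> i. Complex (a $ i) (b $ i))"

lemma cvec_cases:
  obtains a b where "v = cvec a b"
proof -
  have "v = cvec (\<chi> i. Re (v $ i)) (\<chi> i. Im (v $ i))"
    by (simp add: cvec_def vec_eq_iff)
  thus ?thesis by (rule that)
qed

lemma cvec_eq_iff: "cvec a b = cvec c d \<longleftrightarrow> a = c \<and> b = d"
  by (auto simp: cvec_def vec_eq_iff)

lemma cvec_eq_0_iff: "cvec a b = 0 \<longleftrightarrow> a = 0 \<and> b = 0"
  by (auto simp: cvec_def vec_eq_iff complex_eq_iff)

lemma cmat_mult_cvec: "cmat M *v cvec a b = cvec (M *v a) (M *v b)"
  by (auto simp: cmat_def cvec_def vec_eq_iff matrix_vector_mult_def complex_eq_iff)

lemma scale_cvec: "Complex \<alpha> \<beta> *s cvec a b = cvec (\<alpha> *\<^sub>R a - \<beta> *\<^sub>R b) (\<beta> *\<^sub>R a + \<alpha> *\<^sub>R b)"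
  by (auto simp: cvec_def vec_eq_iff complex_eq_iff)

text \<open>The two equations are the real and imaginary parts of F v = z v for v = a + i b and z =
  \<alpha> + i \<beta>.\<close>

lemma stable_iff_real:
  "stable F \<longleftrightarrow> (\<forall>\<alpha> \<beta> a b. F *v a = \<alpha> *\<^sub>R a - \<beta> *\<^sub>R b \<longrightarrow> F *v b = \<beta> *\<^sub>R a + \<alpha> *\<^sub>R b \<longrightarrow>
     0 \<le> \<alpha> \<longrightarrow> a = 0 \<and> b = 0)"
proof safe
  fix \<alpha> \<beta> a b
  assume F: "stable F" "F *v a = \<alpha> *\<^sub>R a - \<beta> *\<^sub>R b" "F *v b = \<beta> *\<^sub>R a + \<alpha> *\<^sub>R b" "0 \<le> \<alpha>"
  have "cmat F *v cvec a b = Complex \<alpha> \<beta> *s cvec a b"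
    using F by (simp add: cmat_mult_cvec scale_cvec)
  with F have "cvec a b = 0"
    by (force simp: stable_def spectrum_def)
  thus "a = 0" "b = 0" by (simp_all add: cvec_eq_0_iff)
next
  assume R: "\<forall>\<alpha> \<beta> a b. F *v a = \<alpha> *\<^sub>R a - \<beta> *\<^sub>R b \<longrightarrow> F *v b = \<beta> *\<^sub>R a + \<alpha> *\<^sub>R b \<longrightarrow>
     0 \<le> \<alpha> \<longrightarrow> a = 0 \<and> b = 0"
  show "stable F"
    unfolding stable_def spectrum_def
  proof safe
    fix z v assume v: "v \<noteq> 0" "cmat F *v v = z *s v"
    obtain a b where ab: "v = cvec a b" by (rule cvec_cases)
    obtain \<alpha> \<beta> where z: "z = Complex \<alpha> \<beta>" by (cases z)
    show "Re z < 0"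
      using R[rule_format, of a \<alpha> \<beta> b] v
      by (force simp: ab z cmat_mult_cvec scale_cvec cvec_eq_iff cvec_eq_0_iff)
  qed
qed

lemma detectable_iff_real:
  "detectable C A \<longleftrightarrow> (\<forall>\<alpha> \<beta> a b. A *v a = \<alpha> *\<^sub>R a - \<beta> *\<^sub>R b \<longrightarrow> A *v b = \<beta> *\<^sub>R a + \<alpha> *\<^sub>R b \<longrightarrow>
     0 \<le> \<alpha> \<longrightarrow> C *v a = 0 \<longrightarrow> C *v b = 0 \<longrightarrow> a = 0 \<and> b = 0)"
proof safe
  fix \<alpha> \<beta> a b
  assume A: "detectable C A" "A *v a = \<alpha> *\<^sub>R a - \<beta> *\<^sub>R b" "A *v b = \<beta> *\<^sub>R a + \<alpha> *\<^sub>R b" "0 \<le> \<alpha>"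
    "C *v a = 0" "C *v b = 0"
  have "cmat A *v cvec a b = Complex \<alpha> \<beta> *s cvec a b" "cmat C *v cvec a b = 0"
    using A by (simp_all add: cmat_mult_cvec scale_cvec cvec_eq_0_iff)
  with A(1,4) have "cvec a b = 0"
    unfolding detectable_def by (metis complex.sel(1))
  thus "a = 0" "b = 0" by (simp_all add: cvec_eq_0_iff)
next
  assume R: "\<forall>\<alpha> \<beta> a b. A *v a = \<alpha> *\<^sub>R a - \<beta> *\<^sub>R b \<longrightarrow> A *v b = \<beta> *\<^sub>R a + \<alpha> *\<^sub>R b \<longrightarrow>
     0 \<le> \<alpha> \<longrightarrow> C *v a = 0 \<longrightarrow> C *v b = 0 \<longrightarrow> a = 0 \<and> b = 0"
  show "detectable C A"
    unfolding detectable_def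
  proof safe
    fix z v assume v: "cmat A *v v = z *s v" "0 \<le> Re z" "cmat C *v v = 0"
    obtain a b where ab: "v = cvec a b" by (rule cvec_cases)
    obtain \<alpha> \<beta> where z: "z = Complex \<alpha> \<beta>" by (cases z)
    show "v = 0"
      using R[rule_format, of a \<alpha> \<beta> b] v
      by (simp add: ab z cmat_mult_cvec scale_cvec cvec_eq_iff cvec_eq_0_iff)
  qed
qed

section \<open>Decay of the powers of a matrix with spectrum in the open unit disc\<close>

lemma tendsto_zero_affine_recurrence:
  fixes x y :: "nat \<Rightarrow> complex"
  assumes rec: "\<And>k. x (Suc k) = \<mu> * x k + y k" and \<mu>: "cmod \<mu> < 1" and y: "y \<longlonglongrightarrow> 0"
  shows "x \<longlonglongrightarrow> 0"
proof (rule LIMSEQ_I)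
  fix e :: real assume e: "0 < e"
  \<comment> \<open>This \<open>d\<close> makes e/2 a fixed point of t -> |\<mu>| t + d, so the
    bound with remainder e/2 reproduces itself at each step.\<close>
  define d where "d = e / 2 * (1 - cmod \<mu>)"
  have "d > 0" using e \<mu> by (simp add: d_def)
  then obtain K where K: "\<And>k. k \<ge> K \<Longrightarrow> cmod (y k) < d"
    using LIMSEQ_D[OF y] by auto
  have bd: "cmod (x (K + j)) \<le> cmod \<mu> ^ j * cmod (x K) + e / 2" for j
  proof (induction j)
    case 0 thus ?case using e by simp
  next
    case (Suc j)
    have "cmod (x (K + Suc j)) \<le> cmod \<mu> * cmod (x (K + j)) + cmod (y (K + j))"
      using norm_triangle_ineq[of "\<mu> * x (K + j)" "y (K + j)"] by (simp add: rec norm_mult)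
    also have "\<dots> \<le> cmod \<mu> * (cmod \<mu> ^ j * cmod (x K) + e / 2) + d"
      using Suc.IH K[of "K + j"] by (intro add_mono mult_left_mono) auto
    also have "\<dots> = cmod \<mu> ^ Suc j * cmod (x K) + e / 2"
      by (simp add: d_def field_simps)
    finally show ?case .
  qed
  have "(\<lambda>j. cmod \<mu> ^ j * cmod (x K)) \<longlonglongrightarrow> 0"
    using \<mu> by (intro tendsto_mult_left_zero LIMSEQ_power_zero) auto
  then obtain J where J: "\<And>j. j \<ge> J \<Longrightarrow> cmod \<mu> ^ j * cmod (x K) < e / 2"
    using LIMSEQ_D[of _ 0 "e/2"] e by fastforce
  show "\<exists>no. \<forall>n\<ge>no. norm (x n - 0) < e"
  proof (intro exI allI impI)
    fix n assume n: "n \<ge> K + J"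
    from n have "J \<le> n - K" by simp
    from bd[of "n - K"] J[OF this] n show "norm (x n - 0) < e" by simp
  qed
qed

text \<open>Induction on a degree bound for a polynomial p with p(W) x = 0, in place of a Jordan
  form. A root \<mu> gives p = (X - \<mu>) q. If |\<mu>| < 1, then q annihilates y = W x - \<mu> x,
  and each coordinate of W^k x satisfies an affine recurrence with factor \<mu> and forcing term
  from W^k y. If |\<mu>| >= 1, then \<mu> is not an eigenvalue, so q already annihilates x.\<close>

lemma matrix_powers_tendsto_zero_poly:
  fixes W :: "complex^'n^'n"
  assumes ev: "\<And>\<mu> v. W *v v = \<mu> *s v \<Longrightarrow> v \<noteq> 0 \<Longrightarrow> cmod \<mu> < 1"
    and "p \<noteq> 0" "degree p \<le> n" "(\<Sum>i\<le>n. coeff p i *s (((*v) W) ^^ i) x) = 0"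
  shows "(\<lambda>k. (((*v) W) ^^ k) x) \<longlonglongrightarrow> 0"
  using assms(2-)
proof (induction n arbitrary: p x)
  case 0
  then obtain c where "p = [:c:]" by (metis degree_eq_zeroE le_zero_eq)
  with 0 have "x = 0" by auto
  moreover have "(((*v) W) ^^ k) 0 = 0" for k by (induction k) auto
  ultimately show ?case by simp
next
  case (Suc n)
  show ?case
  proof (cases "degree p = 0")
    case True
    then obtain c where "p = [:c:]" by (metis degree_eq_zeroE)
    with Suc have p: "p \<noteq> 0" "degree p \<le> n" "(\<Sum>i\<le>n. coeff p i *s (((*v) W) ^^ i) x) = 0"
      by auto
    show ?thesis by (rule Suc.IH[OF p])
  next
    case False
    then have "\<not> constant (poly p)" by (simp add: constant_degree)
    then obtain \<mu> where "poly p \<mu> = 0" using fundamental_theorem_of_algebra by blast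
    then obtain q where q: "p = [:-\<mu>, 1:] * q" by (auto simp: poly_eq_0_iff_dvd)
    with Suc.prems have q0: "q \<noteq> 0" by auto
    have "degree p = Suc (degree q)" using q0 by (simp add: q degree_mult_eq del: mult_pCons_left)
    with Suc.prems have dq: "degree q \<le> n" by simp
    define T where "T = (*v) W"
    have Tsum: "T (sum f A) = (\<Sum>i\<in>A. T (f i))" for f and A :: "nat set"
      unfolding T_def by (induction A rule: infinite_finite_induct)
        (auto simp: matrix_vector_right_distrib)
    have Tsc: "T (c *s v) = c *s T v" for c v
      unfolding T_def by (simp add: vector_scalar_commute)
    have Tdiff: "T (u - v) = T u - T v" for u v
      unfolding T_def by (simp add: matrix_vector_mult_diff_distrib)
    have Tpow: "(T ^^ i) (T x - \<mu> *s x) = (T ^^ Suc i) x - \<mu> *s (T ^^ i) x" for i x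
      by (induction i) (auto simp: Tsc Tdiff)
    \<comment> \<open>Coefficients of X q - \<mu> q; the case distinction is the index shift caused
      by the factor X.\<close>
    have cp: "coeff p i = (case i of 0 \<Rightarrow> 0 | Suc j \<Rightarrow> coeff q j) - \<mu> * coeff q i" for i
      by (cases i) (simp_all add: q)
    have "(\<Sum>i\<le>Suc n. coeff p i *s (T ^^ i) x) =
        (\<Sum>i\<le>Suc n. (case i of 0 \<Rightarrow> 0 | Suc j \<Rightarrow> coeff q j) *s (T ^^ i) x) -
        (\<Sum>i\<le>Suc n. (\<mu> * coeff q i) *s (T ^^ i) x)"
      by (simp only: cp vector_sub_rdistrib sum_subtractf)
    also have "(\<Sum>i\<le>Suc n. (case i of 0 \<Rightarrow> 0 | Suc j \<Rightarrow> coeff q j) *s (T ^^ i) x) =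
        (\<Sum>i\<le>n. coeff q i *s (T ^^ Suc i) x)"
      by (subst sum.atMost_Suc_shift) simp
    also have "(\<Sum>i\<le>Suc n. (\<mu> * coeff q i) *s (T ^^ i) x) = (\<Sum>i\<le>n. (\<mu> * coeff q i) *s (T ^^ i) x)"
      using dq by (simp add: coeff_eq_0)
    finally have eq: "(\<Sum>i\<le>n. coeff q i *s (T ^^ Suc i) x) - (\<Sum>i\<le>n. (\<mu> * coeff q i) *s (T ^^ i) x) = 0"
      using Suc.prems(3) by (simp only: T_def)
    show ?thesis
    proof (cases "cmod \<mu> < 1")
      case True
      define y where "y = T x - \<mu> *s x"
      \<comment> \<open>Here q(W) y = (W - \<mu>) q(W) x = p(W) x = 0.\<close>
      have "(\<Sum>i\<le>n. coeff q i *s (T ^^ i) y) = 0"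
        using eq unfolding y_def Tpow
        by (simp add: vector_ssub_ldistrib sum_subtractf vector_smult_assoc mult.commute del: funpow.simps)
      hence "(\<lambda>k. (T ^^ k) y) \<longlonglongrightarrow> 0"
        unfolding T_def by (rule Suc.IH[OF q0 dq])
      hence yk: "(\<lambda>k. (T ^^ k) y $ i) \<longlonglongrightarrow> 0" for i
        using tendsto_vec_nth by fastforce
      have "(\<lambda>k. (T ^^ k) x $ i) \<longlonglongrightarrow> 0" for i
      proof (rule tendsto_zero_affine_recurrence[OF _ True yk])
        show "(T ^^ Suc k) x $ i = \<mu> * (T ^^ k) x $ i + (T ^^ k) y $ i" for k
          by (simp only: y_def Tpow) simp
      qed
      thus ?thesis by (intro vec_tendstoI) (simp add: T_def)
    next
      case False
      \<comment> \<open>The vector w = q(W) x satisfies (W - \<mu>) w = p(W) x = 0; if it were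
        nonzero, \<mu> would be an eigenvalue outside the open disc.\<close>
      define w where "w = (\<Sum>i\<le>n. coeff q i *s (T ^^ i) x)"
      have "T w = \<mu> *s w"
        using eq by (simp add: w_def Tsum Tsc vec.scale_sum_right vector_smult_assoc)
      with False ev have "w = 0" by (auto simp: T_def)
      thus ?thesis
        using Suc.IH[OF q0 dq, of x] by (simp add: w_def T_def)
    qed
  qed
qed

text \<open>The vectors x, W x, ..., W^N x are linearly dependent once N is the dimension of the
  space, and the relation between them is an annihilating polynomial. Real coefficients suffice, so
  N is the real dimension.\<close>

lemma matrix_powers_tendsto_zero:
  fixes W :: "complex^'n^'n"
  assumes ev: "\<And>\<mu> v. W *v v = \<mu> *s v \<Longrightarrow> v \<noteq> 0 \<Longrightarrow> cmod \<mu> < 1"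
  shows "(\<lambda>k. (((*v) W) ^^ k) x) \<longlonglongrightarrow> 0"
proof -
  define f where "f k = (((*v) W) ^^ k) x" for k
  define N where "N = DIM(complex^'n)"
  have "\<exists>c. (\<exists>i\<le>N. c i \<noteq> 0) \<and> (\<Sum>i\<le>N. c i *\<^sub>R f i) = 0"
  proof (cases "inj_on f {..N}")
    case True
    have "dependent (f ` {..N})"
      by (rule dependent_biggerset) (simp add: card_image[OF True], simp add: N_def)
    then obtain u where u: "\<exists>v\<in>f ` {..N}. u v \<noteq> 0" "(\<Sum>v\<in>f ` {..N}. u v *\<^sub>R v) = 0"
      by (auto simp: dependent_finite)
    thus ?thesis
      by (intro exI[of _ "u \<circ> f"]) (auto simp: sum.reindex True)
  next
    \<comment> \<open>If two iterates coincide, the image has too few elements for the cardinality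
      argument, but the difference of the two monomials is a relation.\<close>
    case False
    then obtain i j where ij: "i \<le> N" "j \<le> N" "i \<noteq> j" "f i = f j" by (auto simp: inj_on_def)
    have "(\<Sum>k\<le>N. (of_bool (k = i) - of_bool (k = j)) *\<^sub>R f k) =
        (\<Sum>k\<le>N. of_bool (k = i) *\<^sub>R f k) - (\<Sum>k\<le>N. of_bool (k = j) *\<^sub>R f k)"
      by (simp add: scaleR_left_diff_distrib sum_subtractf)
    also have "\<dots> = 0"
      using ij by (simp add: of_bool_def if_distrib[of "\<lambda>c. c *\<^sub>R _"] if_distribR cong: if_cong)
    finally show ?thesis
      using ij by (intro exI[of _ "\<lambda>k. of_bool (k = i) - of_bool (k = j)"]) auto
  qed
  then obtain c where c: "\<exists>i\<le>N. c i \<noteq> 0" "(\<Sum>i\<le>N. c i *\<^sub>R f i) = 0" by blast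
  define p where "p = (\<Sum>i\<le>N. monom (complex_of_real (c i)) i)"
  have cp: "coeff p i = (if i \<le> N then complex_of_real (c i) else 0)" for i
    by (simp add: p_def coeff_sum)
  show ?thesis
  proof (rule matrix_powers_tendsto_zero_poly[OF ev])
    show "p \<noteq> 0" using c(1) cp by (metis coeff_0 of_real_eq_0_iff)
    show "degree p \<le> N" by (rule degree_le) (simp add: cp)
    have sc: "complex_of_real r *s v = r *\<^sub>R v" for r and v :: "complex^'n"
      by (simp add: vec_eq_iff scaleR_conv_of_real[where 'a=complex])
    show "(\<Sum>i\<le>N. coeff p i *s (((*v) W) ^^ i) x) = 0"
      using c(2) by (simp add: cp sc f_def)
  qed
qed

section \<open>Lyapunov equations\<close>

lemma inner_transpose_mult: "x \<bullet> (transpose M *v y) = (M *v x) \<bullet> (y::real^'n)"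
  by (metis dot_lmul_matrix inner_commute transpose_matrix_vector)

lemma inner_symmetric_commute:
  "transpose X = X \<Longrightarrow> x \<bullet> (X *v y) = y \<bullet> (X *v (x :: real^'n))"
  by (metis inner_commute inner_transpose_mult)

lemma inner_lyapunov:
  "x \<bullet> ((transpose F ** X + X ** F) *v y) = (F *v x) \<bullet> (X *v y) + x \<bullet> (X *v (F *v (y::real^'n)))"
  by (simp add: matrix_vector_mult_add_rdistrib inner_add_right inner_transpose_mult
      flip: matrix_vector_mul_assoc del: transpose_matrix_vector)

lemma matrix_vector_mult_uminus: "(- A) *v x = - (A *v x)" for A :: "'a::ring_1^'n^'m"
  by (simp add: matrix_vector_mult_def vec_eq_iff sum_negf)

lemma matrix_add_rdistrib: "(A + B) ** C = A ** C + B ** (C :: 'a::semiring_1^'l^'n)"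
  by (simp add: matrix_matrix_mult_def vec_eq_iff sum.distrib distrib_right)

lemma matrix_diff_ldistrib: "A ** (B - C) = A ** B - A ** (C :: 'a::ring_1^'l^'n)"
  by (simp add: matrix_matrix_mult_def vec_eq_iff sum_subtractf right_diff_distrib)

lemma matrix_diff_rdistrib: "(A - B) ** C = A ** C - B ** (C :: 'a::ring_1^'l^'n)"
  by (simp add: matrix_matrix_mult_def vec_eq_iff sum_subtractf left_diff_distrib)

lemma transpose_add: "transpose (A + B) = transpose A + transpose (B :: 'a::plus^'n^'m)"
  by (simp add: transpose_def vec_eq_iff)

lemma transpose_diff: "transpose (A - B) = transpose A - transpose (B :: 'a::minus^'n^'m)"
  by (simp add: transpose_def vec_eq_iff)

lemma transpose_zero: "transpose (0 :: 'a::zero^'n^'m) = 0"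
  by (simp add: transpose_def vec_eq_iff)

lemma transpose_sum: "transpose (sum f A) = (\<Sum>i\<in>A. transpose (f i :: 'a::comm_monoid_add^'n^'m))"
  by (induction A rule: infinite_finite_induct) (simp_all add: transpose_add transpose_zero)

text \<open>The Cayley transform W = (I + F)(I - F)^{-1} maps the open left half-plane to the open
  unit disc, so powers of W can stand in for the flow exp(tF). Parametrising by y = (I - F)^{-1} x
  keeps the inverse out of later arguments.\<close>

lemma stable_cayley_transform:
  fixes F :: "real^'n^'n"
  assumes F: "stable F"
  obtains W :: "real^'n^'n"
  where "\<And>x. \<exists>y. x = y - F *v y \<and> W *v x = y + F *v y"
    and "\<And>x. (\<lambda>k. (((*v) W) ^^ k) x) \<longlonglongrightarrow> 0"
proof -
  have "y = 0" if "(mat 1 - F) *v y = 0" for y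
  proof -
    have "F *v y = y" using that by (simp add: matrix_vector_mult_diff_rdistrib)
    with F show ?thesis
      unfolding stable_iff_real by (metis diff_zero add_0 matrix_vector_mult_0_right scaleR_one
          scaleR_zero_left scaleR_zero_right zero_le_one)
  qed
  hence "invertible (mat 1 - F)"
    using invertible_left_inverse matrix_left_invertible_ker by blast
  then obtain E where E: "(mat 1 - F) ** E = mat 1"
    by (auto simp: invertible_def)
  define W where "W = (mat 1 + F) ** E"
  have x: "E *v x - F *v (E *v x) = x" for x
    by (metis E matrix_vector_mul_assoc matrix_vector_mul_lid matrix_vector_mult_diff_rdistrib)
  have Wx: "W *v x = E *v x + F *v (E *v x)" for x
    by (simp add: W_def matrix_vector_mult_add_rdistrib flip: matrix_vector_mul_assoc)
  have ev: "cmod \<mu> < 1" if \<mu>: "cmat W *v v = \<mu> *s v" and v: "v \<noteq> 0" for \<mu> v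
  proof (rule ccontr)
    assume "\<not> cmod \<mu> < 1"
    define w where "w = cmat E *v v"
    define N where "N = cmat F *v w"
    obtain a b where ab: "v = cvec a b" by (rule cvec_cases)
    have "w - N = cvec (E *v a - F *v (E *v a)) (E *v b - F *v (E *v b))"
      unfolding w_def N_def ab cmat_mult_cvec by (simp add: cvec_def vec_eq_iff complex_eq_iff)
    hence 1: "v = w - N" by (simp only: x ab)
    have "w + N = cvec (E *v a + F *v (E *v a)) (E *v b + F *v (E *v b))"
      unfolding w_def N_def ab cmat_mult_cvec by (simp add: cvec_def vec_eq_iff complex_eq_iff)
    hence 2: "cmat W *v v = w + N" by (simp only: Wx ab cmat_mult_cvec)
    \<comment> \<open>The eigenvalue equation reads w + N = \<mu> (w - N) with N = F w.\<close>
    have 3: "(1 + \<mu>) * N $ i = (\<mu> - 1) * w $ i" for i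
    proof -
      have "(w + N) $ i = (\<mu> *s v) $ i" using 2 \<mu> by simp
      thus ?thesis unfolding 1 by (simp add: algebra_simps)
    qed
    show False
    proof (cases "\<mu> = -1")
      case True
      with 3 have "w = 0" by (simp add: vec_eq_iff)
      with 1 v show False by (simp add: N_def)
    next
      case False
      hence nz: "1 + \<mu> \<noteq> 0" by (metis add.commute add_eq_0_iff)
      \<comment> \<open>The inverse Cayley transform of \<mu>: it is an eigenvalue of F whose real
        part has the sign of |\<mu>|^2 - 1.\<close>
      define l where "l = (\<mu> - 1) / (1 + \<mu>)"
      have "cmat F *v w = l *s w"
        using 3 nz by (simp add: vec_eq_iff l_def N_def[symmetric] field_simps)
      moreover have "w \<noteq> 0" using 1 v by (auto simp: N_def)
      ultimately have "Re l < 0" using F by (auto simp: stable_def spectrum_def)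
      moreover have "Re l = ((cmod \<mu>)\<^sup>2 - 1) / (cmod (1 + \<mu>))\<^sup>2"
        unfolding l_def Re_divide cmod_power2 by (simp add: power2_eq_square algebra_simps)
      moreover have "(cmod \<mu>)\<^sup>2 \<ge> 1" using \<open>\<not> cmod \<mu> < 1\<close> by simp
      ultimately show False by (simp add: divide_less_0_iff)
    qed
  qed
  have pow: "(((*v) (cmat W)) ^^ k) (cvec x 0) = cvec ((((*v) W) ^^ k) x) 0" for k x
    by (induction k) (simp_all add: cmat_mult_cvec)
  show ?thesis
  proof (rule that[of W])
    show "\<exists>y. x = y - F *v y \<and> W *v x = y + F *v y" for x
      by (rule exI[of _ "E *v x"]) (simp add: x Wx)
    show "(\<lambda>k. (((*v) W) ^^ k) x) \<longlonglongrightarrow> 0" for x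
    proof (rule vec_tendstoI)
      fix i
      have "(\<lambda>k. Re (cvec ((((*v) W) ^^ k) x) 0 $ i)) \<longlonglongrightarrow> Re ((0::complex^'n) $ i)"
        using matrix_powers_tendsto_zero[where W = "cmat W" and x = "cvec x 0", OF ev] unfolding pow
        by (intro tendsto_intros)
      thus "(\<lambda>k. (((*v) W) ^^ k) x $ i) \<longlonglongrightarrow> 0 $ i" by (simp add: cvec_def)
    qed
  qed
qed

section \<open>Continuity of the matrix operations\<close>

lemma tendsto_matrix_vector_mult:
  fixes A :: "'a \<Rightarrow> real^'n^'m"
  assumes "(A \<longlongrightarrow> A') F" "(x \<longlongrightarrow> x') F"
  shows "((\<lambda>k. A k *v x k) \<longlongrightarrow> A' *v x') F"
  unfolding matrix_vector_mult_def
  by (intro vec_tendstoI) (auto intro!: tendsto_intros assms)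

lemma tendsto_matrix_mult:
  fixes A :: "'a \<Rightarrow> real^'n^'m" and B :: "'a \<Rightarrow> real^'l^'n"
  assumes "(A \<longlongrightarrow> A') F" "(B \<longlongrightarrow> B') F"
  shows "((\<lambda>k. A k ** B k) \<longlongrightarrow> A' ** B') F"
  unfolding matrix_matrix_mult_def
  by (intro vec_tendstoI) (auto intro!: tendsto_intros assms)

lemma tendsto_transpose:
  fixes A :: "'a \<Rightarrow> real^'n^'m"
  assumes "(A \<longlongrightarrow> A') F"
  shows "((\<lambda>k. transpose (A k)) \<longlongrightarrow> transpose A') F"
  unfolding transpose_def
  by (intro vec_tendstoI) (auto intro!: tendsto_intros assms)

text \<open>For x = y - F y and W x = y + F y, the drop of the form of X from x to W x is twice the
  value at y of the form of -(F^T X + X F), hence nonnegative. So the form decreases along W^k x,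
  and its limit is 0 because W^k x tends to 0.\<close>

lemma lyapunov_pos_semidef:
  fixes X :: "real^'n^'n"
  assumes F: "stable F" and X: "transpose X = X"
    and S: "pos_semidef (- (transpose F ** X + X ** F))"
  shows "pos_semidef X"
  unfolding pos_semidef_def
proof (intro conjI allI X)
  fix x
  obtain W where W: "\<And>x. \<exists>y. x = y - F *v y \<and> W *v x = y + F *v y"
    and lim: "\<And>x. (\<lambda>k. (((*v) W) ^^ k) x) \<longlonglongrightarrow> 0"
    using stable_cayley_transform[OF F] by metis
  have le: "(W *v x) \<bullet> (X *v (W *v x)) \<le> x \<bullet> (X *v x)" for x
  proof -
    obtain y where y: "x = y - F *v y" "W *v x = y + F *v y" using W by blast
    have "0 \<le> y \<bullet> (- (transpose F ** X + X ** F) *v y)"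
      using S by (simp add: pos_semidef_def)
    also have "\<dots> = - ((F *v y) \<bullet> (X *v y) + y \<bullet> (X *v (F *v y)))"
      by (simp only: matrix_vector_mult_uminus inner_minus_right inner_lyapunov)
    finally show ?thesis
      unfolding y(2) by (simp add: y(1) matrix_vector_right_distrib matrix_vector_mult_diff_distrib
          inner_add_left inner_add_right inner_diff_left inner_diff_right)
  qed
  define f where "f k = (((*v) W) ^^ k) x" for k
  have "decseq (\<lambda>k. f k \<bullet> (X *v f k))"
    by (rule decseq_SucI) (simp add: f_def le)
  moreover have "(\<lambda>k. f k \<bullet> (X *v f k)) \<longlonglongrightarrow> 0 \<bullet> (X *v 0)"
    using lim[of x] unfolding f_def by (intro tendsto_intros tendsto_matrix_vector_mult)
  ultimately have "0 \<bullet> (X *v 0) \<le> f 0 \<bullet> (X *v f 0)"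
    by (rule decseq_ge)
  thus "0 \<le> x \<bullet> (X *v x)" by (simp add: f_def)
qed

text \<open>The same computation with equality: the bilinear form of X is invariant under W and also
  tends to 0 along the powers. Working with two vectors covers nonsymmetric X, as injectivity on the
  space of all matrices requires.\<close>

lemma lyapunov_homogeneous_eq_0:
  fixes X :: "real^'n^'n"
  assumes F: "stable F" and X: "transpose F ** X + X ** F = 0"
  shows "X = 0"
proof -
  obtain W where W: "\<And>x. \<exists>y. x = y - F *v y \<and> W *v x = y + F *v y"
    and lim: "\<And>x. (\<lambda>k. (((*v) W) ^^ k) x) \<longlonglongrightarrow> 0"
    using stable_cayley_transform[OF F] by metis
  have inv: "(W *v u) \<bullet> (X *v (W *v v)) = u \<bullet> (X *v v)" for u v
  proof -
    obtain y where y: "u = y - F *v y" "W *v u = y + F *v y" using W by blast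
    obtain z where z: "v = z - F *v z" "W *v v = z + F *v z" using W by blast
    have "(F *v y) \<bullet> (X *v z) + y \<bullet> (X *v (F *v z)) = 0"
      using X inner_lyapunov[of y F X z] by simp
    thus ?thesis
      unfolding y(2) z(2) by (simp add: y(1) z(1) matrix_vector_right_distrib
          matrix_vector_mult_diff_distrib inner_add_left inner_add_right inner_diff_left inner_diff_right)
  qed
  have "u \<bullet> (X *v v) = 0" for u v
  proof -
    define f where "f x k = (((*v) W) ^^ k) x" for k x
    have "f u k \<bullet> (X *v f v k) = u \<bullet> (X *v v)" for k
      by (induction k) (simp_all add: f_def inv)
    moreover have "(\<lambda>k. f u k \<bullet> (X *v f v k)) \<longlonglongrightarrow> 0 \<bullet> (X *v 0)"
      using lim unfolding f_def by (intro tendsto_intros tendsto_matrix_vector_mult)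
    ultimately show ?thesis by (simp add: LIMSEQ_const_iff)
  qed
  hence "X *v v = 0" for v by (metis inner_eq_zero_iff)
  thus ?thesis by (simp add: matrix_eq)
qed

text \<open>The Lyapunov operator is an injective linear map of a finite-dimensional space into
  itself, hence surjective. The transpose of a solution is again a solution, so injectivity also
  gives symmetry.\<close>

lemma lyapunov_solution_exists:
  fixes S :: "real^'n^'n"
  assumes F: "stable F" and S: "transpose S = S"
  obtains X where "transpose X = X" "transpose F ** X + X ** F + S = 0"
proof -
  define T where "T X = transpose F ** X + X ** F" for X :: "real^'n^'n"
  have lin: "linear T"
  proof (rule linearI)
    show "T (X + Y) = T X + T Y" for X Y
      by (simp add: T_def matrix_add_ldistrib matrix_add_rdistrib)
    show "T (c *\<^sub>R X) = c *\<^sub>R T X" for c X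
      by (simp only: T_def matrix_scalar_ac scaleR_add_right scalar_matrix_assoc)
  qed
  have "inj T"
    unfolding linear_injective_0[OF lin] T_def using lyapunov_homogeneous_eq_0[OF F] by blast
  with lin have "surj T" by (rule linear_inj_imp_surj)
  then obtain X where X: "T X = - S" by (metis surjD)
  have "T (transpose X) = transpose (T X)"
    by (simp add: T_def transpose_add matrix_transpose_mul add.commute)
  also have "\<dots> = - S" using S by (simp add: X transpose_def vec_eq_iff)
  finally have "transpose X = X" using \<open>inj T\<close> X by (metis injD)
  with X that show ?thesis by (simp add: T_def)
qed

section \<open>Continuous-time algebraic Riccati equations\<close>

lemmas matrix_ring_simps = matrix_add_ldistrib matrix_add_rdistrib matrix_diff_ldistrib
  matrix_diff_rdistrib matrix_mul_assoc

section \<open>Positive semidefinite matrices\<close>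

lemma pos_semidef_nonneg: "pos_semidef P \<Longrightarrow> 0 \<le> x \<bullet> (P *v x)"
  by (simp add: pos_semidef_def)

lemma pos_semidef_symmetric: "pos_semidef P \<Longrightarrow> transpose P = P"
  by (simp add: pos_semidef_def)

lemma pos_semidef_add: "pos_semidef P \<Longrightarrow> pos_semidef Q \<Longrightarrow> pos_semidef (P + Q)"
  by (simp add: pos_semidef_def transpose_add matrix_vector_mult_add_rdistrib inner_add_right)

lemma pos_semidef_zero: "pos_semidef 0"
  by (simp add: pos_semidef_def transpose_zero)

lemma pos_semidef_congruence:
  assumes "pos_semidef P"
  shows "pos_semidef (transpose M ** P ** M)"
  unfolding pos_semidef_def
proof (intro conjI allI)
  show "transpose (transpose M ** P ** M) = transpose M ** P ** M"
    using assms by (simp add: matrix_transpose_mul pos_semidef_symmetric matrix_mul_assoc)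
  show "0 \<le> x \<bullet> (transpose M ** P ** M *v x)" for x
    using pos_semidef_nonneg[OF assms, of "M *v x"]
    by (simp add: inner_transpose_mult flip: matrix_vector_mul_assoc del: transpose_matrix_vector)
qed

lemma pos_semidef_kernel:
  fixes P :: "real^'n^'n"
  assumes P: "pos_semidef P" and x: "x \<bullet> (P *v x) = 0"
  shows "P *v x = 0"
proof (rule ccontr)
  define w where "w = P *v x"
  define c where "c = w \<bullet> (P *v w)"
  define d where "d = w \<bullet> w"
  \<comment> \<open>A step length for testing the form at x - s w; adding 1 avoids division by zero
    and still gives s c <= d < 2 d.\<close>
  define s where "s = d / (c + 1)"
  assume "P *v x \<noteq> 0"
  hence d: "d > 0" by (simp add: d_def w_def)
  have c: "c \<ge> 0" using P by (simp add: c_def pos_semidef_nonneg)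
  have "x \<bullet> (P *v w) = d"
    using inner_symmetric_commute[OF pos_semidef_symmetric[OF P], of x w] by (simp add: d_def w_def)
  hence "(x - s *\<^sub>R w) \<bullet> (P *v (x - s *\<^sub>R w)) = s * (s * c - 2 * d)"
    using x by (simp add: matrix_vector_mult_diff_distrib matrix_vector_mult_scaleR inner_diff_left
        inner_diff_right c_def d_def algebra_simps flip: w_def)
  hence "0 \<le> s * (s * c - 2 * d)" using P by (metis pos_semidef_nonneg)
  moreover have "s > 0" using c d by (simp add: s_def)
  ultimately have "2 * d \<le> s * c" by (simp add: zero_le_mult_iff)
  also have "s * c \<le> s * (c + 1)" using \<open>s > 0\<close> by simp
  also have "\<dots> = d" using c by (simp add: s_def)
  finally show False using d by simp
qed

lemma pos_semidef_lim:
  fixes Z :: "nat \<Rightarrow> real^'n^'n"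
  assumes Z: "Z \<longlonglongrightarrow> L" and psd: "\<And>k. pos_semidef (Z k)"
  shows "pos_semidef L"
  unfolding pos_semidef_def
proof (intro conjI allI)
  show "transpose L = L"
    using LIMSEQ_unique[OF tendsto_transpose[OF Z]] Z psd by (simp add: pos_semidef_symmetric)
  show "0 \<le> x \<bullet> (L *v x)" for x
    by (rule tendsto_lowerbound[of "\<lambda>k. x \<bullet> (Z k *v x)"])
      (auto intro!: tendsto_intros tendsto_matrix_vector_mult Z always_eventually pos_semidef_nonneg psd)
qed

text \<open>Every quadratic form x . Z_k x decreases and is bounded below by 0; polarization
  recovers the matrix entries from these scalar limits.\<close>

lemma pos_semidef_decreasing_convergent:
  fixes Z :: "nat \<Rightarrow> real^'n^'n"
  assumes psd: "\<And>k. pos_semidef (Z k)" and dec: "\<And>k. pos_semidef (Z k - Z (Suc k))"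
  obtains L where "Z \<longlonglongrightarrow> L"
proof -
  define q where "q x k = x \<bullet> (Z k *v x)" for x k
  have "convergent (q x)" for x
  proof -
    have "decseq (q x)"
      using pos_semidef_nonneg[OF dec, of x]
      by (intro decseq_SucI) (simp add: q_def matrix_vector_mult_diff_rdistrib inner_diff_right)
    then obtain l where "q x \<longlonglongrightarrow> l"
      by (rule decseq_convergent[where B = 0]) (auto simp: q_def pos_semidef_nonneg psd)
    thus ?thesis by (auto simp: convergent_def)
  qed
  hence lim: "q x \<longlonglongrightarrow> lim (q x)" for x by (simp add: convergent_LIMSEQ_iff)
  have polar: "Z k $ i $ j = (q (axis i 1 + axis j 1) k - q (axis i 1 - axis j 1) k) / 4" for k i j
  proof -
    have "axis i 1 \<bullet> (Z k *v axis j 1) = Z k $ i $ j"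
      by (simp add: inner_axis' matrix_vector_mult_basis column_def)
    moreover have "axis j 1 \<bullet> (Z k *v axis i 1) = axis i 1 \<bullet> (Z k *v axis j 1)"
      by (rule inner_symmetric_commute[OF pos_semidef_symmetric[OF psd]])
    ultimately show ?thesis
      by (simp add: q_def matrix_vector_right_distrib matrix_vector_mult_diff_distrib
          inner_add_left inner_add_right inner_diff_left inner_diff_right)
  qed
  define L where
    "L = (\<chi> i j. (lim (q (axis i 1 + axis j 1)) - lim (q (axis i 1 - axis j 1))) / 4)"
  have "Z \<longlonglongrightarrow> L"
    by (intro vec_tendstoI) (auto simp: polar L_def intro!: tendsto_intros lim)
  thus ?thesis by (rule that)
qed

section \<open>Expansion of the Riccati operator and comparison of solutions\<close>

text \<open>The exact second-order expansion at X: the linear term is the Lyapunov operator of the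
  closed loop A - G X. Every comparison below reads off a Lyapunov inequality from it.\<close>

lemma care_op_diff:
  assumes "transpose G = G" "transpose X = X"
  shows "care_op A G H (X - Y) = care_op A G H X -
    (transpose (A - G ** X) ** Y + Y ** (A - G ** X)) - Y ** G ** Y"
  by (simp add: care_op_def transpose_diff matrix_transpose_mul assms matrix_ring_simps algebra_simps)

text \<open>In this form, freezing the closed loop and the term X G X leaves a Lyapunov equation,
  which is the Newton step.\<close>

lemma care_op_closed_loop:
  assumes "transpose G = G" "transpose X = X"
  shows "care_op A G H X = transpose (A - G ** X) ** X + X ** (A - G ** X) + X ** G ** X + H"
  by (simp add: care_op_def transpose_diff matrix_transpose_mul assms matrix_ring_simps algebra_simps)

lemma care_op_symmetric:
  "transpose G = G \<Longrightarrow> transpose H = H \<Longrightarrow> transpose X = X \<Longrightarrow>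
    transpose (care_op A G H X) = care_op A G H X"
  by (simp add: care_op_def transpose_add transpose_diff matrix_transpose_mul matrix_mul_assoc add.commute)

lemma pos_semidef_sandwich: "pos_semidef G \<Longrightarrow> transpose X = X \<Longrightarrow> pos_semidef (X ** G ** X)"
  using pos_semidef_congruence[of G X] by simp

text \<open>Let v = a + i b be an eigenvector of the closed loop with real part \<alpha> >= 0.
  Adding the supersolution inequality at a and at b gives a sum of nonnegative terms that is at most
  0. Hence G P v = 0 and H v = 0, so v is an eigenvector of A in the kernel of H, which
  detectability excludes.\<close>

lemma stable_care_supersolution:
  assumes G: "pos_semidef G" and H: "pos_semidef H" and det: "detectable H A"
    and P: "pos_semidef P" and super: "pos_semidef (- care_op A G H P)"
  shows "stable (A - G ** P)"
  unfolding stable_iff_real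
proof (intro allI impI)
  fix \<alpha> \<beta> a b
  define F where "F = A - G ** P"
  assume "(A - G ** P) *v a = \<alpha> *\<^sub>R a - \<beta> *\<^sub>R b" "(A - G ** P) *v b = \<beta> *\<^sub>R a + \<alpha> *\<^sub>R b" and \<alpha>: "0 \<le> \<alpha>"
  hence Fa: "F *v a = \<alpha> *\<^sub>R a - \<beta> *\<^sub>R b" and Fb: "F *v b = \<beta> *\<^sub>R a + \<alpha> *\<^sub>R b" by (auto simp: F_def)
  have ineq: "(F *v x) \<bullet> (P *v x) + x \<bullet> (P *v (F *v x)) + (P *v x) \<bullet> (G *v (P *v x)) + x \<bullet> (H *v x) \<le> 0" for x
  proof -
    have "x \<bullet> (P ** G ** P *v x) = (P *v x) \<bullet> (G *v (P *v x))"
      by (metis inner_transpose_mult matrix_vector_mul_assoc pos_semidef_symmetric[OF P])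
    moreover have "x \<bullet> (care_op A G H P *v x) \<le> 0"
      using pos_semidef_nonneg[OF super, of x] by (simp add: matrix_vector_mult_uminus)
    moreover have "care_op A G H P = (transpose F ** P + P ** F) + P ** G ** P + H"
      unfolding F_def by (rule care_op_closed_loop) (simp_all add: pos_semidef_symmetric G P)
    ultimately show ?thesis
      by (simp only: matrix_vector_mult_add_rdistrib[of "transpose F ** P + P ** F + P ** G ** P"]
          matrix_vector_mult_add_rdistrib[of "transpose F ** P + P ** F"] inner_add_right inner_lyapunov)
  qed
  have "b \<bullet> (P *v a) = a \<bullet> (P *v b)"
    by (rule inner_symmetric_commute[OF pos_semidef_symmetric[OF P]])
  \<comment> \<open>The terms with \<beta> cancel by the symmetry of P.\<close>
  hence *: "2 * \<alpha> * (a \<bullet> (P *v a) + b \<bullet> (P *v b)) + (P *v a) \<bullet> (G *v (P *v a)) + (P *v b) \<bullet> (G *v (P *v b)) +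
    a \<bullet> (H *v a) + b \<bullet> (H *v b) \<le> 0"
    using ineq[of a] ineq[of b] unfolding Fa Fb
    by (simp add: matrix_vector_right_distrib matrix_vector_mult_diff_distrib matrix_vector_mult_scaleR
        inner_add_left inner_add_right inner_diff_left inner_diff_right algebra_simps)
  have nn: "0 \<le> 2 * \<alpha> * (a \<bullet> (P *v a) + b \<bullet> (P *v b))"
    using \<alpha> P by (simp add: pos_semidef_nonneg)
  note nn = nn pos_semidef_nonneg[OF G, of "P *v a"] pos_semidef_nonneg[OF G, of "P *v b"]
    pos_semidef_nonneg[OF H, of a] pos_semidef_nonneg[OF H, of b]
  have "(P *v a) \<bullet> (G *v (P *v a)) = 0" "(P *v b) \<bullet> (G *v (P *v b)) = 0" "a \<bullet> (H *v a) = 0" "b \<bullet> (H *v b) = 0"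
    using * nn by linarith+
  hence "G *v (P *v a) = 0" "G *v (P *v b) = 0" and H0: "H *v a = 0" "H *v b = 0"
    using G H by (simp_all add: pos_semidef_kernel)
  hence "F *v a = A *v a" "F *v b = A *v b"
    by (simp_all add: F_def matrix_vector_mult_diff_rdistrib flip: matrix_vector_mul_assoc)
  with Fa Fb H0 det \<alpha> show "a = 0 \<and> b = 0"
    unfolding detectable_iff_real by metis
qed

text \<open>Expanding at X shows that -(F^T E + E F), with F = A - G X and E = X - Y, equals the
  Riccati operator at Y plus E G E. Both are positive semidefinite and F is stable.\<close>

lemma care_subsolution_le_stabilizing:
  assumes G: "pos_semidef G" and X: "psd_stabilizing_solution A G H X"
    and Y: "transpose Y = Y" and sub: "pos_semidef (care_op A G H Y)"
  shows "pos_semidef (X - Y)"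
proof (rule lyapunov_pos_semidef)
  have symX: "transpose X = X" and care: "care_op A G H X = 0" and st: "stable (A - G ** X)"
    using X by (auto simp: psd_stabilizing_solution_def pos_semidef_symmetric)
  show "stable (A - G ** X)" by fact
  show sym: "transpose (X - Y) = X - Y" by (simp add: transpose_diff symX Y)
  have "- (transpose (A - G ** X) ** (X - Y) + (X - Y) ** (A - G ** X)) =
      care_op A G H Y + (X - Y) ** G ** (X - Y)"
    using care_op_diff[OF pos_semidef_symmetric[OF G] symX, of A H "X - Y"] care
    by (simp add: algebra_simps)
  thus "pos_semidef (- (transpose (A - G ** X) ** (X - Y) + (X - Y) ** (A - G ** X)))"
    using pos_semidef_add[OF sub pos_semidef_sandwich[OF G sym]] by simp
qed

text \<open>The expansion is now taken at P, so the closed loop that has to be stable is that of the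
  larger matrix.\<close>

lemma care_solution_le_stable_supersolution:
  assumes G: "pos_semidef G" and X: "transpose X = X" "care_op A G H X = 0"
    and P: "transpose P = P" "stable (A - G ** P)" and super: "pos_semidef (- care_op A G H P)"
  shows "pos_semidef (P - X)"
proof (rule lyapunov_pos_semidef)
  show "stable (A - G ** P)" by fact
  show sym: "transpose (P - X) = P - X" by (simp add: transpose_diff X P)
  have "- (transpose (A - G ** P) ** (P - X) + (P - X) ** (A - G ** P)) =
      - care_op A G H P + (P - X) ** G ** (P - X)"
    using care_op_diff[OF pos_semidef_symmetric[OF G] P(1), of A H "P - X"] X(2)
    by (simp add: algebra_simps)
  thus "pos_semidef (- (transpose (A - G ** P) ** (P - X) + (P - X) ** (A - G ** P)))"
    using pos_semidef_add[OF super pos_semidef_sandwich[OF G sym]] by simp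
qed

text \<open>A stabilizing solution dominates every subsolution, hence every other solution;
  antisymmetry of the Loewner order finishes the argument.\<close>

lemma psd_stabilizing_solution_unique:
  assumes G: "pos_semidef G"
    and X: "psd_stabilizing_solution A G H X" and Y: "psd_stabilizing_solution A G H Y"
  shows "X = Y"
proof -
  have "pos_semidef (X - Y)"
    using Y by (intro care_subsolution_le_stabilizing[OF G X])
      (auto simp: psd_stabilizing_solution_def pos_semidef_symmetric pos_semidef_zero)
  moreover have "pos_semidef (Y - X)"
    using X by (intro care_subsolution_le_stabilizing[OF G Y])
      (auto simp: psd_stabilizing_solution_def pos_semidef_symmetric pos_semidef_zero)
  ultimately have "0 \<le> x \<bullet> ((X - Y) *v x)" "0 \<le> x \<bullet> ((Y - X) *v x)" for x
    by (simp_all add: pos_semidef_nonneg)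
  hence "x \<bullet> ((X - Y) *v x) = 0" for x
    by (simp add: matrix_vector_mult_diff_rdistrib inner_diff_right order_antisym)
  hence "(X - Y) *v x = 0" for x using \<open>pos_semidef (X - Y)\<close> by (metis pos_semidef_kernel)
  thus ?thesis by (simp add: matrix_eq matrix_vector_mult_diff_rdistrib)
qed

text \<open>The Kleinman--Newton iteration started at the supersolution \<open>P\<close> decreases to the solution.\<close>

lemma psd_stabilizing_solution_exists:
  assumes G: "pos_semidef G" and H: "pos_semidef H" and det: "detectable H A"
    and P: "pos_semidef P" and super: "pos_semidef (- care_op A G H P)"
  shows "\<exists>X. psd_stabilizing_solution A G H X"
proof -
  \<comment> \<open>\<open>good\<close> is the invariant of the Newton iteration and
    \<open>nxt\<close> its step, a Lyapunov equation with the closed loop of Z.\<close>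
  define good where "good Z \<longleftrightarrow> pos_semidef Z \<and> pos_semidef (- care_op A G H Z)" for Z
  define nxt where "nxt Z Z' \<longleftrightarrow> pos_semidef (Z - Z') \<and>
    transpose (A - G ** Z) ** Z' + Z' ** (A - G ** Z) + (Z ** G ** Z + H) = 0" for Z Z'
  note symG = pos_semidef_symmetric[OF G]
  have step: "\<exists>Z'. good Z' \<and> nxt Z Z'" if Z: "good Z" for Z
  proof -
    have psdZ: "pos_semidef Z" and superZ: "pos_semidef (- care_op A G H Z)"
      using Z by (auto simp: good_def)
    note symZ = pos_semidef_symmetric[OF psdZ]
    define F where "F = A - G ** Z"
    have st: "stable F"
      unfolding F_def by (rule stable_care_supersolution[OF G H det psdZ superZ])
    have S: "pos_semidef (Z ** G ** Z + H)"
      by (intro pos_semidef_add pos_semidef_sandwich G H symZ)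
    obtain Z' where Z': "transpose Z' = Z'" "transpose F ** Z' + Z' ** F + (Z ** G ** Z + H) = 0"
      using lyapunov_solution_exists[OF st pos_semidef_symmetric[OF S]] by metis
    have "- (transpose F ** Z' + Z' ** F) = Z ** G ** Z + H"
      using Z'(2) by (metis add.commute add_eq_0_iff minus_minus)
    with S have psdZ': "pos_semidef Z'" by (intro lyapunov_pos_semidef[OF st Z'(1)]) simp
    \<comment> \<open>The difference Z - Z' solves a Lyapunov equation whose right-hand side is the
      Riccati residual of Z, which is <= 0; hence Z' <= Z.\<close>
    have lyap: "transpose F ** (Z - Z') + (Z - Z') ** F = care_op A G H Z"
      using Z'(2) unfolding care_op_closed_loop[OF symG symZ] F_def[symmetric]
      by (simp add: matrix_ring_simps algebra_simps eq_neg_iff_add_eq_0)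
    have sym: "transpose (Z - Z') = Z - Z'" by (simp add: transpose_diff symZ Z')
    have le: "pos_semidef (Z - Z')"
      using superZ by (intro lyapunov_pos_semidef[OF st sym]) (simp only: lyap)
    \<comment> \<open>The Newton step cancels the linear part, leaving only the quadratic remainder,
      which has the right sign.\<close>
    have "care_op A G H (Z - (Z - Z')) = - ((Z - Z') ** G ** (Z - Z'))"
      unfolding care_op_diff[OF symG symZ] F_def[symmetric] lyap by simp
    hence "pos_semidef (- care_op A G H Z')"
      using pos_semidef_sandwich[OF G sym] by simp
    with psdZ' le Z'(2) show ?thesis by (auto simp: good_def nxt_def F_def)
  qed
  have "\<exists>Z. (\<forall>k. good (Z k)) \<and> (\<forall>k. nxt (Z k) (Z (Suc k)))"
    using dependent_nat_choice[of "\<lambda>_. good" "\<lambda>_. nxt"] step P super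
    by (metis good_def)
  then obtain Z where good: "\<And>k. good (Z k)" and Znext: "\<And>k. nxt (Z k) (Z (Suc k))" by blast
  obtain L where L: "Z \<longlonglongrightarrow> L"
    by (rule pos_semidef_decreasing_convergent[of Z]) (use good Znext in \<open>auto simp: good_def nxt_def\<close>)
  have L': "(\<lambda>k. Z (Suc k)) \<longlonglongrightarrow> L" using L by (rule LIMSEQ_Suc)
  have psdL: "pos_semidef L" by (rule pos_semidef_lim[OF L]) (use good in \<open>auto simp: good_def\<close>)
  have "(\<lambda>k. transpose (A - G ** Z k) ** Z (Suc k) + Z (Suc k) ** (A - G ** Z k) + (Z k ** G ** Z k + H))
      \<longlonglongrightarrow> transpose (A - G ** L) ** L + L ** (A - G ** L) + (L ** G ** L + H)"
    by (intro tendsto_intros tendsto_matrix_mult tendsto_transpose L L')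
  moreover have "transpose (A - G ** L) ** L + L ** (A - G ** L) + (L ** G ** L + H) = care_op A G H L"
    by (simp add: care_op_closed_loop[OF symG pos_semidef_symmetric[OF psdL]] add.assoc)
  ultimately have "care_op A G H L = 0"
    using Znext by (simp add: nxt_def LIMSEQ_const_iff)
  \<comment> \<open>A limit of stable matrices need not be stable; detectability gives strict
    stability because the solution L is its own supersolution.\<close>
  moreover from this have "stable (A - G ** L)"
    by (intro stable_care_supersolution[OF G H det psdL]) (simp add: pos_semidef_zero)
  ultimately show ?thesis using psdL by (auto simp: psd_stabilizing_solution_def)
qed

section \<open>Schur complements and the stochastic coefficients\<close>

lemma pos_def_invertible: "pos_def S \<Longrightarrow> invertible (S :: real^'n^'n)"
  unfolding invertible_left_inverse matrix_left_invertible_ker pos_def_def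
  by (metis inner_zero_right less_irrefl)

lemma matrix_inv_inverse:
  fixes S :: "'a::semiring_1^'n^'n"
  assumes "invertible S"
  shows "S ** matrix_inv S = mat 1" "matrix_inv S ** S = mat 1"
  using someI_ex[OF assms[unfolded invertible_def]] by (simp_all add: matrix_inv_def)

lemma matrix_inv_mult_vec:
  fixes S :: "'a::comm_semiring_1^'n^'n"
  assumes "invertible S"
  shows "S *v (matrix_inv S *v x) = x"
  by (simp add: matrix_vector_mul_assoc matrix_inv_inverse assms)

lemma matrix_inv_symmetric:
  fixes S :: "real^'n^'n"
  assumes "invertible S" "transpose S = S"
  shows "transpose (matrix_inv S) = matrix_inv S"
proof -
  have "transpose (matrix_inv S) ** S = mat 1"
    by (metis assms matrix_inv_inverse(1) matrix_transpose_mul transpose_mat)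
  hence "transpose (matrix_inv S) ** (S ** matrix_inv S) = matrix_inv S"
    by (simp add: matrix_mul_assoc)
  thus ?thesis by (simp add: matrix_inv_inverse assms)
qed

lemma matrix_inv_pos_semidef:
  assumes "pos_def S"
  shows "pos_semidef (matrix_inv S)"
  unfolding pos_semidef_def
proof (intro conjI allI)
  have S: "invertible S" "transpose S = S"
    using assms by (simp_all add: pos_def_invertible) (simp add: pos_def_def)
  show "transpose (matrix_inv S) = matrix_inv S" by (rule matrix_inv_symmetric[OF S])
  fix x
  define y where "y = matrix_inv S *v x"
  have "y \<bullet> (S *v y) \<ge> 0"
    using assms by (cases "y = 0") (auto simp: pos_def_def less_imp_le)
  thus "0 \<le> x \<bullet> (matrix_inv S *v x)"
    by (simp add: y_def matrix_inv_mult_vec[OF S(1)] inner_commute)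
qed

text \<open>By Cramer's rule the entries of the inverse are quotients of determinants, which are
  polynomials in the entries.\<close>

lemma tendsto_matrix_inv:
  fixes S :: "'a \<Rightarrow> real^'n^'n"
  assumes S: "(S \<longlongrightarrow> S') F" and inv: "\<And>k. invertible (S k)" "invertible S'"
  shows "((\<lambda>k. matrix_inv (S k)) \<longlongrightarrow> matrix_inv S') F"
proof -
  \<comment> \<open>\<open>M A i j\<close> is A with column i replaced by the unit vector with index
    j.\<close>
  define M :: "real^'n^'n \<Rightarrow> 'n \<Rightarrow> 'n \<Rightarrow> real^'n^'n"
    where "M A i j = (\<chi> l m. if m = i then axis j 1 $ l else A $ l $ m)" for A i j
  have cramer_inv: "matrix_inv A $ i $ j = det (M A i j) / det A" if A: "invertible A" for A i j
  proof -
    have "det A \<noteq> 0" using A by (simp add: invertible_det_nz)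
    hence "matrix_inv A *v axis j 1 = (\<chi> k. det (M A k j) / det A)"
      unfolding M_def by (rule cramer[THEN iffD1]) (rule matrix_inv_mult_vec[OF A])
    moreover have "(matrix_inv A *v axis j 1) $ i = matrix_inv A $ i $ j"
      by (simp add: matrix_vector_mult_basis column_def)
    ultimately show ?thesis by simp
  qed
  have det: "((\<lambda>k. det (T k)) \<longlongrightarrow> det T') F" if "(T \<longlongrightarrow> T') F" for T :: "'a \<Rightarrow> real^'n^'n" and T'
    unfolding det_def by (intro tendsto_intros that)
  show ?thesis
  proof (intro vec_tendstoI)
    fix i j
    have "((\<lambda>k. M (S k) i j) \<longlongrightarrow> M S' i j) F"
      unfolding M_def by (intro vec_tendstoI) (auto intro!: tendsto_intros S)
    hence "((\<lambda>k. det (M (S k) i j) / det (S k)) \<longlongrightarrow> det (M S' i j) / det S') F"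
      using inv(2) by (intro tendsto_divide det S) (auto simp: invertible_det_nz)
    thus "((\<lambda>k. matrix_inv (S k) $ i $ j) \<longlongrightarrow> matrix_inv S' $ i $ j) F"
      by (simp add: cramer_inv inv)
  qed
qed

text \<open>The Schur complement is the minimum over \<open>u\<close> of the quadratic form of the block matrix.\<close>

lemma schur_complement_quadratic_form:
  fixes M :: "real^'n^'n" and N :: "real^'m^'n" and S :: "real^'m^'m"
  assumes S: "invertible S" "transpose S = S"
  defines "w \<equiv> \<lambda>x u. u + matrix_inv S *v (transpose N *v x)"
  shows "x \<bullet> (M *v x) + 2 * (x \<bullet> (N *v u)) + u \<bullet> (S *v u) =
    x \<bullet> ((M - N ** matrix_inv S ** transpose N) *v x) + w x u \<bullet> (S *v w x u)"
proof -
  define v where "v = matrix_inv S *v (transpose N *v x)"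
  have Sv: "S *v v = transpose N *v x"
    unfolding v_def by (rule matrix_inv_mult_vec[OF S(1)])
  have vSu: "v \<bullet> (S *v u) = x \<bullet> (N *v u)" "u \<bullet> (S *v v) = x \<bullet> (N *v u)"
    using inner_symmetric_commute[OF S(2), of v u]
    by (simp_all add: Sv inner_transpose_mult inner_commute del: transpose_matrix_vector)
  have vSv: "v \<bullet> (S *v v) = x \<bullet> (N *v v)"
    by (simp add: Sv inner_transpose_mult inner_commute del: transpose_matrix_vector)
  have "x \<bullet> ((M - N ** matrix_inv S ** transpose N) *v x) = x \<bullet> (M *v x) - x \<bullet> (N *v v)"
    by (simp only: v_def matrix_vector_mult_diff_rdistrib inner_diff_right matrix_vector_mul_assoc
        matrix_mul_assoc)
  moreover have "w x u = u + v" by (simp add: w_def v_def)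
  ultimately show ?thesis
    using vSu vSv by (simp add: matrix_vector_right_distrib inner_add_left inner_add_right)
qed

text \<open>At the minimizer u of the larger form, that form equals its Schur complement, while the
  smaller form is at least its own.\<close>

lemma schur_complement_mono:
  fixes M M' :: "real^'n^'n" and N N' :: "real^'m^'n"
  assumes S: "pos_def S" "pos_def S'"
    and le: "\<And>x u. x \<bullet> (M *v x) + 2 * (x \<bullet> (N *v u)) + u \<bullet> (S *v u) \<le>
      x \<bullet> (M' *v x) + 2 * (x \<bullet> (N' *v u)) + u \<bullet> (S' *v u)"
  shows "x \<bullet> ((M - N ** matrix_inv S ** transpose N) *v x) \<le>
    x \<bullet> ((M' - N' ** matrix_inv S' ** transpose N') *v x)"
proof -
  define u where "u = - (matrix_inv S' *v (transpose N' *v x))"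
  have S1: "invertible S" "transpose S = S" and S2: "invertible S'" "transpose S' = S'"
    using S by (simp_all add: pos_def_invertible) (simp_all add: pos_def_def)
  have "0 \<le> v \<bullet> (S *v v)" for v
    using S(1) by (cases "v = 0") (auto simp: pos_def_def less_imp_le)
  hence "x \<bullet> ((M - N ** matrix_inv S ** transpose N) *v x) \<le>
      x \<bullet> (M *v x) + 2 * (x \<bullet> (N *v u)) + u \<bullet> (S *v u)"
    unfolding schur_complement_quadratic_form[OF S1] by simp
  also have "\<dots> \<le> x \<bullet> (M' *v x) + 2 * (x \<bullet> (N' *v u)) + u \<bullet> (S' *v u)" by (rule le)
  also have "\<dots> = x \<bullet> ((M' - N' ** matrix_inv S' ** transpose N') *v x)"
    unfolding schur_complement_quadratic_form[OF S2] by (simp add: u_def)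
  finally show ?thesis .
qed

section \<open>The stochastic terms as a block matrix\<close>

lemma sum_matrix_vector_mult: "sum f I *v x = (\<Sum>i\<in>I. f i *v (x :: 'a::semiring_1^'n))"
  by (induction I rule: infinite_finite_induct) (simp_all add: matrix_vector_mult_add_rdistrib)

text \<open>The block matrix of \<open>Pi11\<close>, \<open>Pi12\<close> and \<open>Pi22\<close> is
  a sum of congruences of Y by the block rows of \<open>sys_A0\<close> and \<open>sys_B0\<close>;
  this is the source of its monotonicity in Y.\<close>

lemma Pi_quadratic_form:
  fixes D :: "('n::finite, 'm::finite) scare_data"
  assumes Y: "transpose Y = Y"
  shows "x \<bullet> (Pi11 D Y *v x) + 2 * (x \<bullet> (Pi12 D Y *v u)) + u \<bullet> (Pi22 D Y *v u) =
    (\<Sum>i=1..sys_r D. (sys_A0 D i *v x + sys_B0 D i *v u) \<bullet> (Y *v (sys_A0 D i *v x + sys_B0 D i *v u)))"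
proof -
  have tr: "z \<bullet> (transpose M ** Y ** N *v v) = (M *v z) \<bullet> (Y *v (N *v v))"
    for M :: "real^'k^'n" and N :: "real^'l^'n" and z v
    by (simp add: inner_transpose_mult flip: matrix_vector_mul_assoc del: transpose_matrix_vector)
  have "a \<bullet> (Y *v a) + 2 * (a \<bullet> (Y *v b)) + b \<bullet> (Y *v b) = (a + b) \<bullet> (Y *v (a + b))" for a b
    using inner_symmetric_commute[OF Y, of b a]
    by (simp add: matrix_vector_right_distrib inner_add_left inner_add_right)
  thus ?thesis
    by (simp add: Pi11_def Pi12_def Pi22_def sum_matrix_vector_mult inner_sum_right tr
        sum_distrib_left flip: sum.distrib)
qed

lemma Pi11_symmetric: "transpose Y = Y \<Longrightarrow> transpose (Pi11 D Y) = Pi11 D Y"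
  by (simp add: Pi11_def transpose_sum matrix_transpose_mul matrix_mul_assoc)

lemma pos_semidef_sum: "(\<And>i. i \<in> I \<Longrightarrow> pos_semidef (f i)) \<Longrightarrow> pos_semidef (sum f I)"
  by (induction I rule: infinite_finite_induct) (simp_all add: pos_semidef_zero pos_semidef_add)

lemma Pi22_pos_semidef: "pos_semidef Y \<Longrightarrow> pos_semidef (Pi22 D Y)"
  unfolding Pi22_def by (intro pos_semidef_sum pos_semidef_congruence)

text \<open>The three coefficients combine into one Schur complement, in which Y enters only through
  the affine blocks \<open>Qc\<close>, \<open>Lc\<close> and \<open>Rc\<close>.\<close>

lemma care_op_schur:
  fixes D :: "('n::finite, 'm::finite) scare_data"
  assumes S: "pos_def (Rc D Y)" and X: "transpose X = X"
  shows "care_op (Ac D Y) (Gc D Y) (Hc D Y) X =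
    Qc D Y + (transpose (sys_A D) ** X + X ** sys_A D) -
    (X ** sys_B D + Lc D Y) ** matrix_inv (Rc D Y) ** transpose (X ** sys_B D + Lc D Y)"
proof -
  have "transpose (matrix_inv (Rc D Y)) = matrix_inv (Rc D Y)"
    by (intro matrix_inv_symmetric pos_def_invertible S) (use S in \<open>simp add: pos_def_def\<close>)
  thus ?thesis
    by (simp add: care_op_def Ac_def Gc_def Hc_def transpose_diff transpose_add
        matrix_transpose_mul X matrix_ring_simps algebra_simps)
qed

section \<open>The fixed-point iteration\<close>

lemma zero_loewner_le_iff: "0 \<preceq> X \<longleftrightarrow> pos_semidef X"
  by (simp add: loewner_le_def)

lemma pos_def_add_pos_semidef: "pos_def P \<Longrightarrow> pos_semidef Q \<Longrightarrow> pos_def (P + Q)"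
  by (simp add: pos_def_def pos_semidef_def transpose_add matrix_vector_mult_add_rdistrib
      inner_add_right add_pos_nonneg)

locale scare =
  fixes D :: "('n::finite, 'm::finite) scare_data"
    and C :: "real^'n^'p"
    and Xhat :: "real^'n^'n"
  assumes Q_sym: "transpose (sys_Q D) = sys_Q D"
    and R_pos: "pos_def (sys_R D)"
    and C_decomp: "transpose C ** C =
           sys_Q D - sys_L D ** matrix_inv (sys_R D) ** transpose (sys_L D)"
    and detec: "detectable C (sys_A D)"
    and ker: "mat_ker C \<subseteq> (\<Inter>i\<in>{1..sys_r D}. mat_ker (sys_A0 D i)) \<inter> mat_ker (transpose (sys_L D))"
    and Xhat_psd: "pos_semidef Xhat"
    and Xhat_sol: "scare_op D Xhat = 0"
begin

section \<open>Riccati operators with frozen coefficients\<close>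

abbreviation care where "care Y \<equiv> care_op (Ac D Y) (Gc D Y) (Hc D Y)"

abbreviation stabilizing where
  "stabilizing Y \<equiv> psd_stabilizing_solution (Ac D Y) (Gc D Y) (Hc D Y)"

lemma Rc_pos_def: "pos_semidef Y \<Longrightarrow> pos_def (Rc D Y)"
  unfolding Rc_def by (intro pos_def_add_pos_semidef R_pos Pi22_pos_semidef)

lemma Gc_pos_semidef: "pos_semidef Y \<Longrightarrow> pos_semidef (Gc D Y)"
  using pos_semidef_congruence[OF matrix_inv_pos_semidef[OF Rc_pos_def], of Y "transpose (sys_B D)"]
  by (simp add: Gc_def)

lemma Hc_symmetric:
  assumes "pos_semidef Y"
  shows "transpose (Hc D Y) = Hc D Y"
  using matrix_inv_pos_semidef[OF Rc_pos_def[OF assms]]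
  by (simp add: Hc_def Qc_def transpose_diff transpose_add Q_sym Pi11_symmetric
      pos_semidef_symmetric assms matrix_transpose_mul matrix_mul_assoc)

lemma care_symmetric:
  "pos_semidef Y \<Longrightarrow> transpose X = X \<Longrightarrow> transpose (care Y X) = care Y X"
  by (intro care_op_symmetric Hc_symmetric) (auto intro: pos_semidef_symmetric Gc_pos_semidef)

text \<open>For fixed X the blocks depend on Y only through the stochastic terms, whose quadratic
  form grows with Y; the Schur complement inherits this.\<close>

lemma care_mono:
  assumes Y: "pos_semidef Y" and le: "Y \<preceq> Y'" and X: "transpose X = X"
  shows "care Y X \<preceq> care Y' X"
proof -
  have Y': "pos_semidef Y'"
    using pos_semidef_add[OF Y le[unfolded loewner_le_def]] by simp
  have "z \<bullet> (Y *v z) \<le> z \<bullet> (Y' *v z)" for z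
    using pos_semidef_nonneg[OF le[unfolded loewner_le_def], of z]
    by (simp add: matrix_vector_mult_diff_rdistrib inner_diff_right)
  hence Pi: "x \<bullet> (Pi11 D Y *v x) + 2 * (x \<bullet> (Pi12 D Y *v u)) + u \<bullet> (Pi22 D Y *v u) \<le>
      x \<bullet> (Pi11 D Y' *v x) + 2 * (x \<bullet> (Pi12 D Y' *v u)) + u \<bullet> (Pi22 D Y' *v u)" for x u
    unfolding Pi_quadratic_form[OF pos_semidef_symmetric[OF Y]]
      Pi_quadratic_form[OF pos_semidef_symmetric[OF Y']] by (rule sum_mono)
  have "x \<bullet> (care Y X *v x) \<le> x \<bullet> (care Y' X *v x)" for x
    unfolding care_op_schur[OF Rc_pos_def[OF Y] X] care_op_schur[OF Rc_pos_def[OF Y'] X]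
  proof (rule schur_complement_mono[OF Rc_pos_def[OF Y] Rc_pos_def[OF Y']])
    show "x \<bullet> ((Qc D Y + (transpose (sys_A D) ** X + X ** sys_A D)) *v x) +
        2 * (x \<bullet> ((X ** sys_B D + Lc D Y) *v u)) + u \<bullet> (Rc D Y *v u) \<le>
      x \<bullet> ((Qc D Y' + (transpose (sys_A D) ** X + X ** sys_A D)) *v x) +
        2 * (x \<bullet> ((X ** sys_B D + Lc D Y') *v u)) + u \<bullet> (Rc D Y' *v u)" for x u
      using Pi[of x u]
      by (simp add: Qc_def Lc_def Rc_def matrix_vector_mult_add_rdistrib inner_add_right algebra_simps)
  qed
  hence "0 \<le> x \<bullet> ((care Y' X - care Y X) *v x)" for x
    by (simp add: matrix_vector_mult_diff_rdistrib inner_diff_right)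
  thus ?thesis
    by (simp add: loewner_le_def pos_semidef_def transpose_diff care_symmetric[OF Y X]
        care_symmetric[OF Y' X])
qed

lemma Hc_zero: "Hc D 0 = transpose C ** C"
  by (simp add: C_decomp Hc_def Qc_def Lc_def Rc_def Pi11_def Pi12_def Pi22_def)

text \<open>At X = 0 the Riccati operator reduces to its constant term, so this is monotonicity
  between 0 and Y.\<close>

lemma Hc_ge:
  assumes Y: "pos_semidef Y"
  shows "transpose C ** C \<preceq> Hc D Y"
  using care_mono[OF pos_semidef_zero, of Y 0] Y
  by (simp add: zero_loewner_le_iff transpose_zero care_op_def flip: Hc_zero)

lemma gram_nonneg: "x \<bullet> (transpose C ** C *v x) = (norm (C *v x))\<^sup>2"
  by (simp add: inner_transpose_mult power2_norm_eq_inner flip: matrix_vector_mul_assoc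
      del: transpose_matrix_vector)

lemma Hc_pos_semidef:
  assumes Y: "pos_semidef Y"
  shows "pos_semidef (Hc D Y)"
proof -
  have "pos_semidef (transpose C ** C)"
    by (simp add: pos_semidef_def gram_nonneg matrix_transpose_mul)
  from pos_semidef_add[OF this Hc_ge[OF Y, unfolded loewner_le_def]] show ?thesis by simp
qed

text \<open>Since \<open>Hc D Y\<close> dominates C^T C, its kernel lies in that of C. The kernel
  condition then annihilates every \<open>sys_A0 D i *v x\<close> and the term with
  \<open>sys_L D\<close>, so the feedback correction in \<open>Ac D Y\<close> vanishes at x.\<close>

lemma Hc_kernel:
  assumes Y: "pos_semidef Y" and x: "Hc D Y *v x = 0"
  shows "C *v x = 0" "Ac D Y *v x = sys_A D *v x"
proof -
  have "0 \<le> x \<bullet> ((Hc D Y - transpose C ** C) *v x)"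
    using Hc_ge[OF Y] by (intro pos_semidef_nonneg) (simp add: loewner_le_def)
  hence "(norm (C *v x))\<^sup>2 \<le> 0"
    using x by (simp add: matrix_vector_mult_diff_rdistrib inner_diff_right gram_nonneg)
  thus C: "C *v x = 0" by simp
  with ker have A0: "sys_A0 D i *v x = 0" if "i \<in> {1..sys_r D}" for i
    using that by (auto simp: mat_ker_def simp del: transpose_matrix_vector)
  have "transpose (sys_L D) *v x = 0"
    using ker C by (auto simp: mat_ker_def simp del: transpose_matrix_vector)
  hence "transpose (Lc D Y) *v x = 0"
    by (simp add: Lc_def Pi12_def transpose_add transpose_sum matrix_transpose_mul sum_matrix_vector_mult
        matrix_vector_mult_add_rdistrib A0 flip: matrix_vector_mul_assoc del: transpose_matrix_vector)
  thus "Ac D Y *v x = sys_A D *v x"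
    by (simp add: Ac_def matrix_vector_mult_diff_rdistrib flip: matrix_vector_mul_assoc
        del: transpose_matrix_vector)
qed

lemma Hc_detectable:
  assumes "pos_semidef Y"
  shows "detectable (Hc D Y) (Ac D Y)"
  using detec unfolding detectable_iff_real by (metis Hc_kernel[OF assms])

section \<open>The invariant of the iteration\<close>

text \<open>The induction invariant. Its last conjunct says that Y is a subsolution of the equation
  with coefficients frozen at Y, which makes the next iterate dominate Y.\<close>

definition below :: "real^'n^'n \<Rightarrow> bool" where
  "below Y \<longleftrightarrow> pos_semidef Y \<and> Y \<preceq> Xhat \<and> pos_semidef (scare_op D Y)"

lemma below_zero: "below 0"
proof -
  have "scare_op D 0 = Hc D 0"
    by (simp add: scare_op_def care_op_def)
  thus ?thesis
    using Hc_pos_semidef[OF pos_semidef_zero] Xhat_psd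
    by (simp add: below_def zero_loewner_le_iff pos_semidef_zero)
qed

text \<open>Raising the coefficients from Y to \<open>Xhat\<close> can only increase the operator at
  \<open>Xhat\<close>, and there it reaches 0.\<close>

lemma Xhat_supersolution:
  assumes "below Y"
  shows "pos_semidef (- care Y Xhat)"
  using care_mono[of Y Xhat Xhat] assms Xhat_psd Xhat_sol
  by (simp add: below_def loewner_le_def scare_op_def pos_semidef_symmetric)

lemma below_stable:
  assumes Y: "below Y"
  shows "stable (Ac D Y - Gc D Y ** Xhat)"
proof -
  have psd: "pos_semidef Y" using Y by (simp add: below_def)
  show ?thesis
    by (rule stable_care_supersolution[OF Gc_pos_semidef[OF psd] Hc_pos_semidef[OF psd]
          Hc_detectable[OF psd] Xhat_psd Xhat_supersolution[OF Y]])
qed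

lemma below_stabilizing_exists:
  assumes Y: "below Y"
  shows "\<exists>Z. stabilizing Y Z"
proof -
  have psd: "pos_semidef Y" using Y by (simp add: below_def)
  show ?thesis
    by (rule psd_stabilizing_solution_exists[OF Gc_pos_semidef[OF psd] Hc_pos_semidef[OF psd]
          Hc_detectable[OF psd] Xhat_psd Xhat_supersolution[OF Y]])
qed

lemma below_stabilizing_unique:
  "below Y \<Longrightarrow> stabilizing Y Z \<Longrightarrow> stabilizing Y Z' \<Longrightarrow> Z = Z'"
  unfolding below_def by (metis Gc_pos_semidef psd_stabilizing_solution_unique)

lemma below_stabilizing:
  assumes Y: "below Y" and Z: "stabilizing Y Z"
  shows "Y \<preceq> Z" "below Z"
proof -
  have psdY: "pos_semidef Y" and psdZ: "pos_semidef Z" and Z0: "care Y Z = 0"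
    using Y Z by (auto simp: below_def psd_stabilizing_solution_def)
  note G = Gc_pos_semidef[OF psdY]
  show le: "Y \<preceq> Z"
    unfolding loewner_le_def using Y
    by (intro care_subsolution_le_stabilizing[OF G Z])
      (auto simp: below_def pos_semidef_symmetric scare_op_def)
  have "Z \<preceq> Xhat"
    unfolding loewner_le_def
    by (rule care_solution_le_stable_supersolution[OF G pos_semidef_symmetric[OF psdZ] Z0
          pos_semidef_symmetric[OF Xhat_psd] below_stable[OF Y] Xhat_supersolution[OF Y]])
  \<comment> \<open>The operator at Z vanishes with coefficients frozen at Y, and Y <= Z, so
    updating them to Z makes it nonnegative.\<close>
  moreover have "pos_semidef (scare_op D Z)"
    using care_mono[OF psdY le pos_semidef_symmetric[OF psdZ]] Z0
    by (simp add: scare_op_def zero_loewner_le_iff)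
  ultimately show "below Z" using psdZ by (simp add: below_def)
qed

lemma iteration_below:
  assumes "scare_iteration D X"
  shows "below (X k)"
proof (induction k)
  case 0
  show ?case using assms below_zero by (simp add: scare_iteration_def)
next
  case (Suc k)
  show ?case using assms by (intro below_stabilizing(2)[OF Suc]) (simp add: scare_iteration_def)
qed

lemma iteration_exists_unique: "\<exists>!X. scare_iteration D X"
proof (rule ex_ex1I)
  \<comment> \<open>The condition at k = 0 fixes the initial value inside the dependent
    choice.\<close>
  obtain X where X: "\<And>k. below (X k) \<and> (k = 0 \<longrightarrow> X k = 0)" "\<And>k. stabilizing (X k) (X (Suc k))"
    using dependent_nat_choice[of "\<lambda>k Y. below Y \<and> (k = 0 \<longrightarrow> Y = 0)" "\<lambda>_. stabilizing"]
      below_zero below_stabilizing_exists below_stabilizing(2) by (metis nat.discI)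
  thus "\<exists>X. scare_iteration D X" by (auto simp: scare_iteration_def)
next
  fix X Y assume X: "scare_iteration D X" and Y: "scare_iteration D Y"
  have "X k = Y k" for k
  proof (induction k)
    case (Suc k)
    have "stabilizing (X k) (X (Suc k))" using X by (simp add: scare_iteration_def)
    moreover have "stabilizing (X k) (Y (Suc k))" using Y by (simp add: scare_iteration_def Suc)
    ultimately show ?case by (rule below_stabilizing_unique[OF iteration_below[OF X]])
  qed (use X Y in \<open>simp add: scare_iteration_def\<close>)
  thus "X = Y" by blast
qed

section \<open>Passage to the limit\<close>

lemma tendsto_scare_coefficients:
  assumes X: "X \<longlonglongrightarrow> L" and psd: "\<And>k. pos_semidef (X k)" "pos_semidef L"
  shows "(\<lambda>k. Ac D (X k)) \<longlonglongrightarrow> Ac D L" "(\<lambda>k. Gc D (X k)) \<longlonglongrightarrow> Gc D L"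
    "(\<lambda>k. Hc D (X k)) \<longlonglongrightarrow> Hc D L"
proof -
  have Rc: "(\<lambda>k. Rc D (X k)) \<longlonglongrightarrow> Rc D L" and Lc: "(\<lambda>k. Lc D (X k)) \<longlonglongrightarrow> Lc D L"
    and Qc: "(\<lambda>k. Qc D (X k)) \<longlonglongrightarrow> Qc D L"
    unfolding Rc_def Lc_def Qc_def Pi11_def Pi12_def Pi22_def
    by (intro tendsto_intros tendsto_matrix_mult X)+
  have inv: "(\<lambda>k. matrix_inv (Rc D (X k))) \<longlonglongrightarrow> matrix_inv (Rc D L)"
    by (intro tendsto_matrix_inv Rc pos_def_invertible Rc_pos_def psd)
  show "(\<lambda>k. Ac D (X k)) \<longlonglongrightarrow> Ac D L" "(\<lambda>k. Gc D (X k)) \<longlonglongrightarrow> Gc D L"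
    "(\<lambda>k. Hc D (X k)) \<longlonglongrightarrow> Hc D L"
    unfolding Ac_def Gc_def Hc_def
    by (intro tendsto_intros tendsto_matrix_mult tendsto_transpose Rc Lc Qc inv)+
qed

lemma iteration_limit:
  assumes X: "scare_iteration D X"
  obtains L where "X \<longlonglongrightarrow> L" "pos_semidef L" "L \<preceq> Xhat" "scare_op D L = 0"
    "stable (Ac D L - Gc D L ** L)"
proof -
  have below: "below (X k)" for k by (rule iteration_below[OF X])
  have psd: "pos_semidef (X k)" and le: "pos_semidef (Xhat - X k)" for k
    using below[of k] by (auto simp: below_def loewner_le_def)
  have st: "stabilizing (X k) (X (Suc k))" for k using X by (simp add: scare_iteration_def)
  \<comment> \<open>The increasing iterates bounded by \<open>Xhat\<close> become a decreasing
    positive semidefinite sequence.\<close>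
  have "pos_semidef ((Xhat - X k) - (Xhat - X (Suc k)))" for k
    using below_stabilizing(1)[OF below st, of k] by (simp add: loewner_le_def)
  then obtain M where "(\<lambda>k. Xhat - X k) \<longlonglongrightarrow> M"
    by (rule pos_semidef_decreasing_convergent[of "\<lambda>k. Xhat - X k", OF le])
  hence "(\<lambda>k. Xhat - (Xhat - X k)) \<longlonglongrightarrow> Xhat - M" by (intro tendsto_diff tendsto_const)
  then obtain L where L: "X \<longlonglongrightarrow> L" by simp
  have psdL: "pos_semidef L" by (rule pos_semidef_lim[OF L psd])
  have "pos_semidef (Xhat - L)"
    by (rule pos_semidef_lim[OF tendsto_diff[OF tendsto_const L] le])
  note coeffs = tendsto_scare_coefficients[OF L psd psdL]
  \<comment> \<open>Coefficients at index k and argument at index k + 1 have the same limit.\<close>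
  have "(\<lambda>k. care (X k) (X (Suc k))) \<longlonglongrightarrow> care L L"
    unfolding care_op_def
    by (intro tendsto_add tendsto_diff tendsto_matrix_mult tendsto_transpose LIMSEQ_Suc[OF L] coeffs)
  hence sol: "care L L = 0"
    using st by (simp add: psd_stabilizing_solution_def LIMSEQ_const_iff)
  moreover have "stable (Ac D L - Gc D L ** L)"
    by (rule stable_care_supersolution[OF Gc_pos_semidef[OF psdL] Hc_pos_semidef[OF psdL]
          Hc_detectable[OF psdL] psdL]) (simp add: sol pos_semidef_zero)
  ultimately show ?thesis
    using that[OF L psdL] \<open>pos_semidef (Xhat - L)\<close> by (simp add: loewner_le_def scare_op_def)
qed

end

text \<open>The iteration is a predicate on sequences; the conjunct that exactly one sequence
  satisfies it keeps the claims about all such sequences from being vacuous.\<close>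

theorem theorem3p3:
  fixes D :: "('n::finite, 'm::finite) scare_data"
    and C :: "real^'n^'p"
    and Xhat :: "real^'n^'n"
  assumes Q_sym: "transpose (sys_Q D) = sys_Q D"
    and R_pos: "pos_def (sys_R D)"
    and QLR_psd: "0 \<preceq> sys_Q D - sys_L D ** matrix_inv (sys_R D) ** transpose (sys_L D)"
    and C_decomp: "full_rank_decomposition C
           (sys_Q D - sys_L D ** matrix_inv (sys_R D) ** transpose (sys_L D))"
    and stab: "stabilizable (sys_A D) (sys_B D)"
    and detec: "detectable C (sys_A D)"
    and ker: "mat_ker C \<subseteq> (\<Inter>i\<in>{1..sys_r D}. mat_ker (sys_A0 D i)) \<inter> mat_ker (transpose (sys_L D))"
    and Xhat_psd: "0 \<preceq> Xhat"
    and Xhat_sol: "scare_op D Xhat = 0"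
  shows "(\<exists>!X. scare_iteration D X) \<and>
    (\<forall>X. scare_iteration D X \<longrightarrow>
      (\<forall>k. X k \<preceq> X (Suc k) \<and> X k \<preceq> Xhat \<and> 0 \<preceq> scare_op D (X k) \<and>
           stable (Ac D (X k) - Gc D (X k) ** Xhat)) \<and>
      (\<exists>Xminus. X \<longlonglongrightarrow> Xminus \<and>
           0 \<preceq> Xminus \<and> Xminus \<preceq> Xhat \<and> scare_op D Xminus = 0 \<and>
           spectrum (Ac D Xminus - Gc D Xminus ** Xminus) \<subseteq> {z. Re z \<le> 0}))"
proof -
  interpret scare D C Xhat
    using assms by unfold_locales (simp_all add: full_rank_decomposition_def zero_loewner_le_iff)
  show ?thesis
  proof (intro conjI allI impI)
    show "\<exists>!X. scare_iteration D X" by (rule iteration_exists_unique)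
  next
    fix X k assume X: "scare_iteration D X"
    have below: "below (X k)" by (rule iteration_below[OF X])
    show "X k \<preceq> X (Suc k)"
      by (rule below_stabilizing(1)[OF below]) (use X in \<open>simp add: scare_iteration_def\<close>)
    show "X k \<preceq> Xhat" "0 \<preceq> scare_op D (X k)"
      using below by (simp_all add: below_def zero_loewner_le_iff)
    show "stable (Ac D (X k) - Gc D (X k) ** Xhat)" by (rule below_stable[OF below])
  next
    fix X assume X: "scare_iteration D X"
    show "\<exists>Xminus. X \<longlonglongrightarrow> Xminus \<and> 0 \<preceq> Xminus \<and> Xminus \<preceq> Xhat \<and> scare_op D Xminus = 0 \<and>
        spectrum (Ac D Xminus - Gc D Xminus ** Xminus) \<subseteq> {z. Re z \<le> 0}"
      by (rule iteration_limit[OF X])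
        (auto simp: zero_loewner_le_iff stable_def less_imp_le intro!: exI)
  qed
qed

end
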